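(* Let $G$ be a finite group of order $n\geq 2$, and let $\mathbb{S}_G$ be the set of invertible Frobenius matrices associated to $G$, i.e. the set of all matrices $(a_{gh^{-1}})_{g,h\in G}$ with $(a_g)_{g\in G}\in\mathbb{C}^{G}$ and $\det\big((a_{gh^{-1}})_{g,h\in G}\big)\neq 0$. Then $\mathbb{S}_G$ (under matrix multiplication) is a connected linear algebraic group over $\mathbb{C}$. It is linear reductive when $G$ is non-abelian, and it is commutative when $G$ is abelian. Moreover, let $\mathfrak{s}_G$ be the Lie algebra of $\mathbb{S}_G$. If $G$ is non-abelian, then the derived Lie algebra $\mathfrak{s}_G^{(1)}=[\mathfrak{s}_G,\mathfrak{s}_G]$ of $\mathfrak{s}_G$ is semi-simple.
   Context: Rows and columns of the matrices $(a_{gh^{-1}})_{g,h\in G}$ are indexed by the elements of $G$ (in a fixed order), so $\mathbb{S}_G\subset GL(n,\mathbb{C})$. A linear algebraic group over $\mathbb{C}$ is a Zariski closed subgroup of some $GL(n,\mathbb{C})$. Linear reductivity of $\mathbb{S}_G$ means that its Lie algebra $\mathfrak{s}_G$ is reductive, i.e. that the largest solvable ideal $\mathrm{rad}\,\mathfrak{s}_G$ of $\mathfrak{s}_G$ equals the center of $\mathfrak{s}_G$. The derived Lie algebra $\mathfrak{s}_G^{(1)}$ is the ideal of $\mathfrak{s}_G$ generated by all Lie brackets of elements of $\mathfrak{s}_G$. A Lie algebra is semi-simple if it contains no nonzero solvable ideal. *)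

theory Defs
  imports "HOL-Analysis.Analysis" "HOL-Algebra.Group"
begin

text \<open>Square matrices have a finite type \<open>'n\<close> as index type. A map \<open>e\<close>, later assumed to be a bijection
  from \<open>'n\<close> onto the carrier of \<open>G\<close>, fixes the order in which \<open>G\<close> indexes rows and columns.\<close>

definition frobenius_matrix ::
  "('a, 'b) monoid_scheme \<Rightarrow> ('n::finite \<Rightarrow> 'a) \<Rightarrow> ('a \<Rightarrow> complex) \<Rightarrow> complex ^ 'n ^ 'n" where
  "frobenius_matrix G e a = (\<chi> i j. a (e i \<otimes>\<^bsub>G\<^esub> inv\<^bsub>G\<^esub> e j))"

definition invertible_frobenius_matrices ::
  "('a, 'b) monoid_scheme \<Rightarrow> ('n::finite \<Rightarrow> 'a) \<Rightarrow> (complex ^ 'n ^ 'n) set" where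
  "invertible_frobenius_matrices G e =
     {frobenius_matrix G e a | a. det (frobenius_matrix G e a) \<noteq> 0}"

definition GL :: "(complex ^ 'n ^ 'n) monoid" where
  "GL = \<lparr>carrier = {A. invertible A}, mult = (**), one = mat 1\<rparr>"

text \<open>Polynomials in the matrix entries, represented by the functions they induce; this loses nothing
  because the complex field is infinite.\<close>

inductive_set matrix_polynomials :: "(complex ^ 'n ^ 'n \<Rightarrow> complex) set" where
  const: "(\<lambda>A. c) \<in> matrix_polynomials"
| entry: "(\<lambda>A. A $ i $ j) \<in> matrix_polynomials"
| add: "f \<in> matrix_polynomials \<Longrightarrow> g \<in> matrix_polynomials \<Longrightarrow> (\<lambda>A. f A + g A) \<in> matrix_polynomials"
| mult: "f \<in> matrix_polynomials \<Longrightarrow> g \<in> matrix_polynomials \<Longrightarrow> (\<lambda>A. f A * g A) \<in> matrix_polynomials"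

definition zariski_closed :: "(complex ^ 'n ^ 'n) set \<Rightarrow> bool" where
  "zariski_closed Z \<longleftrightarrow> (\<exists>P \<subseteq> matrix_polynomials. Z = {A. \<forall>f\<in>P. f A = 0})"

definition zariski_topology :: "(complex ^ 'n ^ 'n) topology" where
  "zariski_topology = topology (\<lambda>U. zariski_closed (- U))"

lemma zariski_closed_Un:
  assumes "zariski_closed Y" "zariski_closed Z"
  shows "zariski_closed (Y \<union> Z)"
proof -
  obtain P Q where P: "P \<subseteq> matrix_polynomials" "Y = {A. \<forall>f\<in>P. f A = 0}"
    and Q: "Q \<subseteq> matrix_polynomials" "Z = {A. \<forall>f\<in>Q. f A = 0}"
    using assms unfolding zariski_closed_def by blast
  let ?R = "{\<lambda>A. f A * g A | f g. f \<in> P \<and> g \<in> Q}"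
  have "?R \<subseteq> matrix_polynomials"
    using P(1) Q(1) by (auto intro: matrix_polynomials.mult)
  moreover have "Y \<union> Z = {A. \<forall>h\<in>?R. h A = 0}"
  proof (intro Set.set_eqI iffI)
    fix A assume "A \<in> Y \<union> Z"
    then have "f A * g A = 0" if "f \<in> P" "g \<in> Q" for f g
      using that P(2) Q(2) by auto
    then show "A \<in> {A. \<forall>h\<in>?R. h A = 0}" by blast
  next
    fix A assume A: "A \<in> {A. \<forall>h\<in>?R. h A = 0}"
    have "f A * g A = 0" if "f \<in> P" "g \<in> Q" for f g
    proof -
      have "(\<lambda>A. f A * g A) \<in> ?R" using that by blast
      from bspec [OF CollectD [OF A] this] show ?thesis .
    qed
    then have "(\<forall>f\<in>P. f A = 0) \<or> (\<forall>g\<in>Q. g A = 0)" using no_zero_divisors by blast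
    then show "A \<in> Y \<union> Z" using P(2) Q(2) by blast
  qed
  ultimately show ?thesis unfolding zariski_closed_def by blast
qed

lemma zariski_closed_Inter:
  assumes "\<And>Z. Z \<in> \<Z> \<Longrightarrow> zariski_closed Z"
  shows "zariski_closed (\<Inter>\<Z>)"
proof -
  have "\<exists>P. P \<subseteq> matrix_polynomials \<and> (\<forall>A. A \<in> Z \<longleftrightarrow> (\<forall>f\<in>P. f A = 0))" if "Z \<in> \<Z>" for Z
    using assms [OF that] unfolding zariski_closed_def by auto
  then obtain P where P: "\<And>Z. Z \<in> \<Z> \<Longrightarrow> P Z \<subseteq> matrix_polynomials"
    "\<And>Z A. Z \<in> \<Z> \<Longrightarrow> A \<in> Z \<longleftrightarrow> (\<forall>f\<in>P Z. f A = 0)"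
    by metis
  have "\<Union>(P ` \<Z>) \<subseteq> matrix_polynomials" using P(1) by blast
  moreover have "\<Inter>\<Z> = {A. \<forall>f\<in>\<Union>(P ` \<Z>). f A = 0}"
    by (rule Set.set_eqI) (simp add: P(2) Ball_def, blast)
  ultimately show ?thesis unfolding zariski_closed_def by blast
qed

lemma istopology_zariski: "istopology (\<lambda>U. zariski_closed (- U))"
  unfolding istopology_def
proof (intro conjI allI impI)
  fix S T :: "(complex ^ 'n ^ 'n) set"
  assume "zariski_closed (- S)" "zariski_closed (- T)"
  then show "zariski_closed (- (S \<inter> T))" by (simp add: Compl_Int zariski_closed_Un)
next
  fix \<K> :: "(complex ^ 'n ^ 'n) set set"
  assume "\<forall>K\<in>\<K>. zariski_closed (- K)"
  then have "zariski_closed (\<Inter>(uminus ` \<K>))" by (intro zariski_closed_Inter) auto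
  moreover have "- \<Union>\<K> = \<Inter>(uminus ` \<K>)" by auto
  ultimately show "zariski_closed (- \<Union>\<K>)" by simp
qed

lemma openin_zariski: "openin zariski_topology U \<longleftrightarrow> zariski_closed (- U)"
  by (simp add: zariski_topology_def istopology_zariski)

lemma topspace_zariski [simp]: "topspace zariski_topology = UNIV"
proof -
  have "zariski_closed ({} :: (complex ^ 'n ^ 'n) set)"
    unfolding zariski_closed_def
    by (intro exI[of _ "{\<lambda>A. 1}"]) (auto intro: matrix_polynomials.const)
  then have "openin zariski_topology (UNIV :: (complex ^ 'n ^ 'n) set)"
    by (simp add: openin_zariski)
  then show ?thesis by (metis openin_subset top.extremum_uniqueI)
qed

lemma closedin_zariski: "closedin zariski_topology Z \<longleftrightarrow> zariski_closed Z"
  unfolding closedin_def openin_zariski by (simp add: Diff_eq)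

definition linear_algebraic_group :: "(complex ^ 'n ^ 'n) set \<Rightarrow> bool" where
  "linear_algebraic_group S \<longleftrightarrow>
     subgroup S GL \<and> closedin (subtopology zariski_topology (carrier GL)) S"

definition cscale :: "complex \<Rightarrow> complex ^ 'n ^ 'n \<Rightarrow> complex ^ 'n ^ 'n" (infixr \<open>*\<^sub>C\<close> 75) where
  "c *\<^sub>C A = (\<chi> i j. c * A $ i $ j)"

interpretation cmat: vector_space "cscale :: complex \<Rightarrow> complex ^ 'n ^ 'n \<Rightarrow> complex ^ 'n ^ 'n"
  by (standard; simp add: cscale_def vec_eq_iff distrib_left distrib_right)

definition lie_bracket :: "complex ^ 'n ^ 'n \<Rightarrow> complex ^ 'n ^ 'n \<Rightarrow> complex ^ 'n ^ 'n" where
  "lie_bracket X Y = X ** Y - Y ** X"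

definition lie_subalgebra :: "(complex ^ 'n ^ 'n) set \<Rightarrow> bool" where
  "lie_subalgebra L \<longleftrightarrow> cmat.subspace L \<and> (\<forall>X\<in>L. \<forall>Y\<in>L. lie_bracket X Y \<in> L)"

definition lie_ideal :: "(complex ^ 'n ^ 'n) set \<Rightarrow> (complex ^ 'n ^ 'n) set \<Rightarrow> bool" where
  "lie_ideal I L \<longleftrightarrow> cmat.subspace I \<and> I \<subseteq> L \<and> (\<forall>X\<in>L. \<forall>Y\<in>I. lie_bracket X Y \<in> I)"

definition lie_center :: "(complex ^ 'n ^ 'n) set \<Rightarrow> (complex ^ 'n ^ 'n) set" where
  "lie_center L = {X \<in> L. \<forall>Y\<in>L. lie_bracket X Y = 0}"

definition derived_algebra :: "(complex ^ 'n ^ 'n) set \<Rightarrow> (complex ^ 'n ^ 'n) set" where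
  "derived_algebra L = \<Inter>{I. lie_ideal I L \<and> (\<forall>X\<in>L. \<forall>Y\<in>L. lie_bracket X Y \<in> I)}"

definition lie_solvable :: "(complex ^ 'n ^ 'n) set \<Rightarrow> bool" where
  "lie_solvable L \<longleftrightarrow> (\<exists>k. (derived_algebra ^^ k) L = {0})"

definition is_radical :: "(complex ^ 'n ^ 'n) set \<Rightarrow> (complex ^ 'n ^ 'n) set \<Rightarrow> bool" where
  "is_radical R L \<longleftrightarrow> lie_ideal R L \<and> lie_solvable R \<and>
     (\<forall>I. lie_ideal I L \<and> lie_solvable I \<longrightarrow> I \<subseteq> R)"

definition reductive :: "(complex ^ 'n ^ 'n) set \<Rightarrow> bool" where
  "reductive L \<longleftrightarrow> lie_subalgebra L \<and> is_radical (lie_center L) L"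

definition semisimple :: "(complex ^ 'n ^ 'n) set \<Rightarrow> bool" where
  "semisimple L \<longleftrightarrow> lie_subalgebra L \<and> (\<forall>I. lie_ideal I L \<and> lie_solvable I \<longrightarrow> I = {0})"

text \<open>The Lie algebra of a closed subgroup of \<open>GL\<close> is its Zariski tangent space at the identity: the
  common kernel of the differentials at the identity of all polynomials vanishing on the group.
  Allowing the inverse determinant as a further coordinate function does not change this space.\<close>

definition lie_algebra_of :: "(complex ^ 'n ^ 'n) set \<Rightarrow> (complex ^ 'n ^ 'n) set" where
  "lie_algebra_of S = {X. \<forall>f\<in>matrix_polynomials. (\<forall>A\<in>S. f A = 0) \<longrightarrow>
     ((\<lambda>t. f (mat 1 + t *\<^sub>C X)) has_field_derivative 0) (at 0)}"

definition linearly_reductive :: "(complex ^ 'n ^ 'n) set \<Rightarrow> bool" where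
  "linearly_reductive S \<longleftrightarrow> reductive (lie_algebra_of S)"

end

theory Submission
  imports Defs
begin

text \<open>A matrix has the form \<open>a (g h\<inverse>)\<close> exactly when its entries do not change if both indices are
  multiplied on the right by the same group element. The Frobenius matrices are therefore the
  matrices invariant under a set of simultaneous permutations of rows and columns
  (\<open>range_frobenius_matrix\<close>). For any set of permutations the invariant matrices form an algebra \<open>V\<close>
  that is cut out by linear equations, contains the inverses of its invertible elements and is
  closed under conjugate transposition. The theorem follows from these facts alone, without
  decomposing the group algebra into matrix blocks.

  \<^item> The invertible elements of \<open>V\<close> form an algebraic group. Two of them lie on a complex line in
    \<open>V\<close>, which meets the zero set of the determinant in finitely many points. A plane minus finitely
    many points is connected, so the group is connected in the Euclidean topology and hence in the
    coarser Zariski topology.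

  \<^item> Its Lie algebra is \<open>V\<close>: the linear equations of \<open>V\<close> vanish on the group, and a polynomial
    that vanishes on the group vanishes on the whole of \<open>V\<close>, because its product with the determinant
    does so and polynomials in one variable have no zero divisors.

  \<^item> Let \<open>L\<close> be a Lie algebra of matrices closed under conjugate transposition \<open>X \<mapsto> X\<^sup>*\<close>. The form
    \<open>tr (X Y\<^sup>*)\<close> is positive definite and \<open>tr (X Y)\<close> is invariant under brackets. If \<open>J\<close> is an
    abelian ideal of \<open>L\<close> and \<open>X \<in> J\<close>, then \<open>ad X\<close> has square zero on \<open>L\<close>. Applied to \<open>X\<^sup>*\<close> this makes
    \<open>X\<close> normal, and for normal \<open>X\<close> the operator \<open>ad X\<close> is normal too, so that its vanishing square
    forces it to vanish (\<open>ad_square_zero\<close>). Abelian ideals are thus central, and induction along the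
    derived series extends this to solvable ideals (\<open>solvable_ideal_central\<close>). So \<open>L\<close> is reductive.
    Its derived algebra \<open>D\<close> is again closed under conjugate transposition, hence every solvable ideal
    of \<open>D\<close> lies in the center of \<open>D\<close>. That center is zero, because its elements are central in
    \<open>L\<close> and therefore orthogonal to all brackets, that is, to \<open>D\<close> itself.

  \<^item> If the group is abelian, inversion of the indices turns every Frobenius matrix into its
    transpose, but it preserves products while transposition reverses them.\<close>

section \<open>Brackets, conjugate transposes and the trace form\<close>

lemma matrix_add_rdistrib: "(B + C) ** A = B ** A + C ** (A :: complex ^ 'n ^ 'n)"
  by (vector matrix_matrix_mult_def distrib_right sum.distrib)

lemma matrix_sub_ldistrib: "A ** (B - C) = A ** B - A ** (C :: complex ^ 'n ^ 'n)"
  by (vector matrix_matrix_mult_def right_diff_distrib sum_subtractf)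

lemma matrix_sub_rdistrib: "(B - C) ** A = B ** A - C ** (A :: complex ^ 'n ^ 'n)"
  by (vector matrix_matrix_mult_def left_diff_distrib sum_subtractf)

lemma cscale_mult_left: "(c *\<^sub>C A) ** B = c *\<^sub>C (A ** B)"
  by (simp add: cscale_def matrix_matrix_mult_def vec_eq_iff sum_distrib_left mult.assoc)

lemma cscale_mult_right: "A ** (c *\<^sub>C B) = c *\<^sub>C (A ** B)"
  by (simp add: cscale_def matrix_matrix_mult_def vec_eq_iff sum_distrib_left mult.left_commute)

lemma trace_zero [simp]: "trace (0 :: complex ^ 'n ^ 'n) = 0"
  by (simp add: trace_def)

lemma trace_cscale: "trace (c *\<^sub>C A) = c * trace A"
  by (simp add: trace_def cscale_def sum_distrib_left)

lemma lie_bracket_add_right: "lie_bracket X (Y + Z) = lie_bracket X Y + lie_bracket X Z"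
  by (simp add: lie_bracket_def matrix_add_ldistrib matrix_add_rdistrib)

lemma lie_bracket_add_left: "lie_bracket (Y + Z) X = lie_bracket Y X + lie_bracket Z X"
  by (simp add: lie_bracket_def matrix_add_ldistrib matrix_add_rdistrib)

lemma lie_bracket_cscale_right: "lie_bracket X (c *\<^sub>C Y) = c *\<^sub>C lie_bracket X Y"
  by (simp add: lie_bracket_def cscale_mult_left cscale_mult_right cmat.scale_right_diff_distrib)

lemma lie_bracket_cscale_left: "lie_bracket (c *\<^sub>C Y) X = c *\<^sub>C lie_bracket Y X"
  by (simp add: lie_bracket_def cscale_mult_left cscale_mult_right cmat.scale_right_diff_distrib)

lemma lie_bracket_0_left [simp]: "lie_bracket 0 X = 0"
  using lie_bracket_add_left[of 0 0 X] by simp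

lemma lie_bracket_0_right [simp]: "lie_bracket X 0 = 0"
  using lie_bracket_add_right[of X 0 0] by simp

lemma lie_bracket_skew: "lie_bracket Y X = - lie_bracket X Y"
  by (simp add: lie_bracket_def)

lemma lie_bracket_eq_0_commute: "lie_bracket X Y = 0 \<longleftrightarrow> lie_bracket Y X = 0"
  by (metis lie_bracket_skew neg_equal_0_iff_equal)

lemma lie_bracket_minus_right: "lie_bracket X (- Y) = - lie_bracket X Y"
  using lie_bracket_add_right[of X Y "- Y"] by (simp add: eq_neg_iff_add_eq_0 add.commute)

text \<open>The Jacobi identity, in the form that \<open>ad X\<close> is a derivation.\<close>

lemma jacobi_derivation:
  "lie_bracket X (lie_bracket Y Z) =
     lie_bracket (lie_bracket X Y) Z + lie_bracket Y (lie_bracket X Z)"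
  by (simp add: lie_bracket_def matrix_sub_ldistrib matrix_sub_rdistrib matrix_mul_assoc)

definition conj_transpose :: "complex ^ 'n ^ 'n \<Rightarrow> complex ^ 'n ^ 'n" where
  "conj_transpose A = (\<chi> i j. cnj (A $ j $ i))"

lemma conj_transpose_conj_transpose [simp]: "conj_transpose (conj_transpose A) = A"
  by (simp add: conj_transpose_def vec_eq_iff)

lemma conj_transpose_0 [simp]: "conj_transpose 0 = 0"
  by (simp add: conj_transpose_def vec_eq_iff)

lemma conj_transpose_add: "conj_transpose (A + B) = conj_transpose A + conj_transpose B"
  by (simp add: conj_transpose_def vec_eq_iff)

lemma conj_transpose_diff: "conj_transpose (A - B) = conj_transpose A - conj_transpose B"
  by (simp add: conj_transpose_def vec_eq_iff)

lemma conj_transpose_cscale: "conj_transpose (c *\<^sub>C A) = cnj c *\<^sub>C conj_transpose A"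
  by (simp add: conj_transpose_def cscale_def vec_eq_iff)

lemma conj_transpose_mult: "conj_transpose (A ** B) = conj_transpose B ** conj_transpose A"
  by (simp add: conj_transpose_def matrix_matrix_mult_def vec_eq_iff mult.commute)

lemma conj_transpose_bracket:
  "conj_transpose (lie_bracket X Y) = lie_bracket (conj_transpose Y) (conj_transpose X)"
  by (simp add: lie_bracket_def conj_transpose_mult conj_transpose_diff)

lemma trace_conj_transpose_eq_0:
  assumes "trace (A ** conj_transpose A) = 0"
  shows "A = 0"
proof -
  have "trace (A ** conj_transpose A) = of_real (\<Sum>i\<in>UNIV. \<Sum>j\<in>UNIV. (cmod (A $ i $ j))\<^sup>2)"
    unfolding trace_def matrix_matrix_mult_def conj_transpose_def
    by (simp add: complex_norm_square flip: of_real_power)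
  then have "(\<Sum>i\<in>UNIV. \<Sum>j\<in>UNIV. (cmod (A $ i $ j))\<^sup>2) = 0"
    using assms by (metis of_real_eq_0_iff)
  then have "cmod (A $ i $ j) ^ 2 = 0" for i j
    by (simp add: sum_nonneg_eq_0_iff sum_nonneg)
  then show ?thesis by (simp add: vec_eq_iff)
qed

lemma trace_bracket_invariant:
  "trace (lie_bracket X Y ** Z) = trace (X ** lie_bracket Y Z)"
proof -
  have "trace (Y ** X ** Z) = trace (X ** Z ** Y)"
    by (metis matrix_mul_assoc trace_mul_sym)
  then show ?thesis
    by (simp add: lie_bracket_def matrix_sub_ldistrib matrix_sub_rdistrib matrix_mul_assoc trace_sub)
qed

text \<open>The main device for showing that brackets vanish: by invariance the squared norm of
  \<open>[X, Y]\<close> is \<open>tr (X [Y, [X, Y]\<^sup>*])\<close>.\<close>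

lemma bracket_eq_0_if_commutes_conj_transpose:
  assumes "lie_bracket Y (conj_transpose (lie_bracket X Y)) = 0"
  shows "lie_bracket X Y = 0"
  by (rule trace_conj_transpose_eq_0)
    (simp add: trace_bracket_invariant assms)

text \<open>The theorem of Fuglede for matrices. Normality of \<open>X\<close> means that \<open>ad X\<close> commutes with
  \<open>ad X\<^sup>*\<close>, so the hypothesis gives \<open>[X\<^sup>*, [Z, X\<^sup>*]\<^sup>*] = [X\<^sup>*, [X, Z\<^sup>*]] = [X, [X\<^sup>*, Z\<^sup>*]] = 0\<close>.\<close>

lemma normal_commutant_conj_transpose:
  assumes normal: "lie_bracket X (conj_transpose X) = 0" and comm: "lie_bracket X Z = 0"
  shows "lie_bracket (conj_transpose X) Z = 0"
proof -
  let ?X' = "conj_transpose X" and ?Z' = "conj_transpose Z"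
  have "lie_bracket ?X' (lie_bracket X ?Z') =
      lie_bracket (lie_bracket ?X' X) ?Z' + lie_bracket X (lie_bracket ?X' ?Z')"
    by (rule jacobi_derivation)
  also have "lie_bracket ?X' ?Z' = 0"
    using comm by (metis conj_transpose_bracket conj_transpose_0 lie_bracket_eq_0_commute)
  also have "lie_bracket ?X' X = 0"
    using normal by (metis lie_bracket_eq_0_commute)
  finally have "lie_bracket ?X' (conj_transpose (lie_bracket Z ?X')) = 0"
    by (simp add: conj_transpose_bracket)
  then have "lie_bracket Z ?X' = 0"
    by (rule bracket_eq_0_if_commutes_conj_transpose)
  then show ?thesis by (metis lie_bracket_eq_0_commute)
qed

text \<open>The first hypothesis forces \<open>X\<close> to be normal. Since \<open>X\<close> commutes with \<open>[X, Y]\<close>, so does \<open>X\<^sup>*\<close>,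
  and then \<open>[X, Y]\<close> is orthogonal to itself.\<close>

lemma ad_square_zero:
  assumes self: "lie_bracket X (lie_bracket X (conj_transpose X)) = 0"
    and sq: "lie_bracket X (lie_bracket X Y) = 0"
  shows "lie_bracket X Y = 0"
proof -
  have normal: "lie_bracket X (conj_transpose X) = 0"
  proof (rule bracket_eq_0_if_commutes_conj_transpose)
    show "lie_bracket (conj_transpose X) (conj_transpose (lie_bracket X (conj_transpose X))) = 0"
      by (metis self conj_transpose_bracket conj_transpose_0 lie_bracket_eq_0_commute)
  qed
  have "lie_bracket (conj_transpose X) (lie_bracket X Y) = 0"
    by (rule normal_commutant_conj_transpose[OF normal sq])
  then have "conj_transpose (lie_bracket (conj_transpose X) (lie_bracket Y X)) = 0"
    by (simp add: lie_bracket_skew[of Y X] lie_bracket_minus_right)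
  then have "lie_bracket X (conj_transpose (lie_bracket Y X)) = 0"
    by (metis conj_transpose_bracket conj_transpose_conj_transpose lie_bracket_eq_0_commute)
  then have "lie_bracket Y X = 0"
    by (rule bracket_eq_0_if_commutes_conj_transpose)
  then show ?thesis by (metis lie_bracket_eq_0_commute)
qed

section \<open>Solvable ideals of self-adjoint Lie algebras\<close>

lemma cmat_subspace_bracket_vimage:
  assumes "cmat.subspace V"
  shows "cmat.subspace {Z. lie_bracket X Z \<in> V}"
  using assms by (simp add: cmat.subspace_def lie_bracket_add_right lie_bracket_cscale_right)

abbreviation brackets :: "(complex ^ 'n ^ 'n) set \<Rightarrow> (complex ^ 'n ^ 'n) set" where
  "brackets J \<equiv> {lie_bracket X Y | X Y. X \<in> J \<and> Y \<in> J}"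

text \<open>The derived algebra of a Lie algebra is the smallest ideal containing its brackets; the span of
  the brackets is already an ideal. Allowing brackets with a larger algebra \<open>L\<close> shows at the same
  time that all terms of the derived series of an ideal of \<open>L\<close> are ideals of \<open>L\<close>.\<close>

lemma lie_ideal_span_brackets:
  assumes J: "lie_ideal J L"
  shows "lie_ideal (cmat.span (brackets J)) L"
proof -
  have "cmat.span (brackets J) \<subseteq> J"
    using J by (intro cmat.span_minimal) (auto simp: lie_ideal_def)
  then have "cmat.span (brackets J) \<subseteq> L"
    using J by (auto simp: lie_ideal_def)
  moreover have "lie_bracket X Z \<in> cmat.span (brackets J)"
    if X: "X \<in> L" and Z: "Z \<in> cmat.span (brackets J)" for X Z
  proof -
    have "lie_bracket X (lie_bracket U V) \<in> cmat.span (brackets J)" if "U \<in> J" "V \<in> J" for U V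
    proof -
      have "lie_bracket X U \<in> J" "lie_bracket X V \<in> J"
        using J X that by (auto simp: lie_ideal_def)
      then show ?thesis
        unfolding jacobi_derivation[of X U V] using that
        by (intro cmat.span_add cmat.span_base) blast+
    qed
    then have "brackets J \<subseteq> {Z. lie_bracket X Z \<in> cmat.span (brackets J)}"
      by blast
    then have "cmat.span (brackets J) \<subseteq> {Z. lie_bracket X Z \<in> cmat.span (brackets J)}"
      by (intro cmat.span_minimal cmat_subspace_bracket_vimage cmat.subspace_span)
    with Z show ?thesis by blast
  qed
  ultimately show ?thesis
    by (simp add: lie_ideal_def)
qed

lemma lie_ideal_self: "lie_subalgebra L \<Longrightarrow> lie_ideal L L"
  by (auto simp: lie_ideal_def lie_subalgebra_def)

lemma lie_ideal_imp_subalgebra: "lie_ideal J L \<Longrightarrow> lie_subalgebra J"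
  by (auto simp: lie_ideal_def lie_subalgebra_def)

lemma lie_ideal_bracket_left:
  assumes "lie_ideal J L" and "X \<in> J" and "Y \<in> L"
  shows "lie_bracket X Y \<in> J"
  using assms by (simp add: lie_ideal_def lie_bracket_skew[of X Y] cmat.subspace_neg)

lemma derived_algebra_eq_span:
  assumes "lie_subalgebra L"
  shows "derived_algebra L = cmat.span (brackets L)"
proof
  have "lie_ideal (cmat.span (brackets L)) L"
    by (intro lie_ideal_span_brackets lie_ideal_self assms)
  moreover have "lie_bracket X Y \<in> cmat.span (brackets L)" if "X \<in> L" "Y \<in> L" for X Y
    using that by (intro cmat.span_base) blast
  ultimately show "derived_algebra L \<subseteq> cmat.span (brackets L)"
    unfolding derived_algebra_def by blast
  show "cmat.span (brackets L) \<subseteq> derived_algebra L"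
    unfolding derived_algebra_def
    by (intro Inter_greatest cmat.span_minimal) (auto simp: lie_ideal_def)
qed

lemma lie_ideal_derived_algebra:
  assumes "lie_ideal J L"
  shows "lie_ideal (derived_algebra J) L"
  using lie_ideal_span_brackets[OF assms]
  by (simp add: derived_algebra_eq_span lie_ideal_imp_subalgebra[OF assms])

lemma lie_bracket_in_derived_algebra:
  "X \<in> L \<Longrightarrow> Y \<in> L \<Longrightarrow> lie_bracket X Y \<in> derived_algebra L"
  by (auto simp: derived_algebra_def)

definition self_adjoint :: "(complex ^ 'n ^ 'n) set \<Rightarrow> bool" where
  "self_adjoint L \<longleftrightarrow> (\<forall>X\<in>L. conj_transpose X \<in> L)"

lemma self_adjoint_derived_algebra:
  assumes L: "lie_subalgebra L" and sa: "self_adjoint L"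
  shows "self_adjoint (derived_algebra L)"
proof -
  have "cmat.subspace {Z. conj_transpose Z \<in> cmat.span (brackets L)}"
    by (simp add: cmat.subspace_def cmat.span_zero cmat.span_add cmat.span_scale
        conj_transpose_add conj_transpose_cscale)
  moreover have "brackets L \<subseteq> {Z. conj_transpose Z \<in> cmat.span (brackets L)}"
    using sa by (auto simp: conj_transpose_bracket self_adjoint_def intro!: cmat.span_base) blast
  ultimately have "cmat.span (brackets L) \<subseteq> {Z. conj_transpose Z \<in> cmat.span (brackets L)}"
    by (rule cmat.span_minimal[rotated])
  then show ?thesis
    by (auto simp: derived_algebra_eq_span[OF L] self_adjoint_def)
qed

lemma conj_transpose_lie_center:
  assumes sa: "self_adjoint L" and X: "X \<in> lie_center L"
  shows "conj_transpose X \<in> lie_center L"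
proof -
  have "lie_bracket (conj_transpose X) Y = 0" if "Y \<in> L" for Y
  proof -
    have "lie_bracket X (conj_transpose Y) = 0"
      using sa X that by (simp add: self_adjoint_def lie_center_def)
    then show ?thesis
      by (metis conj_transpose_bracket conj_transpose_conj_transpose conj_transpose_0
          lie_bracket_eq_0_commute)
  qed
  then show ?thesis
    using sa X by (simp add: self_adjoint_def lie_center_def)
qed

text \<open>For \<open>X \<in> J\<close> and \<open>Y \<in> L\<close> both \<open>X\<close> and \<open>[X, Y]\<close> lie in the abelian ideal \<open>J\<close>, so \<open>ad X\<close> has square
  zero on \<open>L\<close>, which contains \<open>X\<^sup>*\<close>.\<close>

lemma abelian_ideal_central:
  assumes sa: "self_adjoint L" and J: "lie_ideal J L"
    and ab: "\<And>X Y. X \<in> J \<Longrightarrow> Y \<in> J \<Longrightarrow> lie_bracket X Y = 0"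
  shows "J \<subseteq> lie_center L"
proof
  fix X assume X: "X \<in> J"
  then have XL: "X \<in> L" using J by (auto simp: lie_ideal_def)
  have sq: "lie_bracket X (lie_bracket X Y) = 0" if "Y \<in> L" for Y
    by (intro ab X lie_ideal_bracket_left[OF J] that)
  have "lie_bracket X Y = 0" if "Y \<in> L" for Y
    using sa XL that ad_square_zero[of X Y] sq by (auto simp: self_adjoint_def)
  with XL show "X \<in> lie_center L" by (simp add: lie_center_def)
qed

text \<open>The adjoint of a central element is central, so it commutes with \<open>Y\<close>.\<close>

lemma central_bracket_eq_0:
  assumes sa: "self_adjoint L" and "Y \<in> L"
    and "lie_bracket X Y \<in> lie_center L"
  shows "lie_bracket X Y = 0"
proof (rule bracket_eq_0_if_commutes_conj_transpose)
  have "conj_transpose (lie_bracket X Y) \<in> lie_center L"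
    by (rule conj_transpose_lie_center) fact+
  then show "lie_bracket Y (conj_transpose (lie_bracket X Y)) = 0"
    using \<open>Y \<in> L\<close> lie_bracket_eq_0_commute by (auto simp: lie_center_def)
qed

text \<open>Induction on the derived length: the derived algebra of \<open>I\<close> is central by the induction hypothesis, but
  central brackets vanish, so \<open>I\<close> is abelian.\<close>

lemma solvable_ideal_central:
  assumes sa: "self_adjoint L" and L: "lie_subalgebra L"
    and I: "lie_ideal I L" and "lie_solvable I"
  shows "I \<subseteq> lie_center L"
proof -
  obtain k where "(derived_algebra ^^ k) I = {0}"
    using \<open>lie_solvable I\<close> by (auto simp: lie_solvable_def)
  then show ?thesis
    using I
  proof (induction k arbitrary: I)
    case 0
    then show ?case
      using L by (auto simp: lie_center_def lie_subalgebra_def cmat.subspace_0)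
  next
    case (Suc k)
    then have D: "derived_algebra I \<subseteq> lie_center L"
      by (intro Suc.IH lie_ideal_derived_algebra) (simp_all add: funpow_swap1)
    show ?case
    proof (rule abelian_ideal_central[OF sa Suc.prems(2)])
      fix X Y assume "X \<in> I" "Y \<in> I"
      moreover from this have "lie_bracket X Y \<in> lie_center L"
        using D lie_bracket_in_derived_algebra by blast
      ultimately show "lie_bracket X Y = 0"
        using Suc.prems(2) by (intro central_bracket_eq_0[OF sa]) (auto simp: lie_ideal_def)
    qed
  qed
qed

lemma lie_ideal_center:
  assumes "lie_subalgebra L"
  shows "lie_ideal (lie_center L) L"
proof -
  have "lie_bracket X Y = 0" if "X \<in> L" "Y \<in> lie_center L" for X Y
    using that lie_bracket_eq_0_commute by (auto simp: lie_center_def)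
  then show ?thesis
    using assms
    by (auto simp: lie_ideal_def lie_center_def lie_subalgebra_def cmat.subspace_def
        lie_bracket_add_left lie_bracket_cscale_left)
qed

lemma lie_solvable_center:
  assumes "lie_subalgebra L"
  shows "lie_solvable (lie_center L)"
proof -
  have "derived_algebra (lie_center L) = cmat.span (brackets (lie_center L))"
    by (rule derived_algebra_eq_span[OF lie_ideal_imp_subalgebra[OF lie_ideal_center[OF assms]]])
  also have "\<dots> \<subseteq> {0}"
    by (rule cmat.span_minimal) (auto simp: lie_center_def)
  finally have "derived_algebra (lie_center L) = {0}"
    using lie_ideal_derived_algebra[OF lie_ideal_center[OF assms]]
    by (auto simp: lie_ideal_def dest: cmat.subspace_0)
  then have "(derived_algebra ^^ 1) (lie_center L) = {0}" by simp
  then show ?thesis unfolding lie_solvable_def by blast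
qed

proposition self_adjoint_reductive:
  assumes "self_adjoint L" and "lie_subalgebra L"
  shows "reductive L"
  using assms by (auto simp: reductive_def is_radical_def lie_ideal_center lie_solvable_center
      dest: solvable_ideal_central)

text \<open>For \<open>C\<close> in this center and \<open>Y \<in> L\<close>, the bracket \<open>[C, Y]\<close> lies in the derived algebra and therefore
  commutes with \<open>C\<close>; hence \<open>C\<close> is central in \<open>L\<close>. Its adjoint is central as well, which by invariance
  of the trace makes \<open>C\<close> orthogonal to all brackets, and so to itself.\<close>

lemma lie_center_derived_algebra:
  assumes sa: "self_adjoint L" and L: "lie_subalgebra L"
  shows "lie_center (derived_algebra L) = {0}"
proof -
  let ?D = "derived_algebra L"
  have D: "lie_ideal ?D L"
    by (intro lie_ideal_derived_algebra lie_ideal_self L)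
  have "C = 0" if C: "C \<in> lie_center ?D" for C
  proof -
    have CL: "C \<in> L" using C D by (auto simp: lie_center_def lie_ideal_def)
    have sq: "lie_bracket C (lie_bracket C Y) = 0" if "Y \<in> L" for Y
      using C lie_bracket_in_derived_algebra[OF CL that] by (auto simp: lie_center_def)
    have "lie_bracket C Y = 0" if "Y \<in> L" for Y
      using sa CL that ad_square_zero[of C Y] sq by (auto simp: self_adjoint_def)
    with CL have "C \<in> lie_center L" by (simp add: lie_center_def)
    then have C': "conj_transpose C \<in> lie_center L"
      by (rule conj_transpose_lie_center[OF sa])
    have "cmat.span (brackets L) \<subseteq> {Z. trace (Z ** conj_transpose C) = 0}"
    proof (rule cmat.span_minimal)
      have "trace (lie_bracket X Y ** conj_transpose C) = 0" if "Y \<in> L" for X Y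
      proof -
        have "lie_bracket Y (conj_transpose C) = 0"
          using C' that lie_bracket_eq_0_commute by (auto simp: lie_center_def)
        then show ?thesis by (simp add: trace_bracket_invariant)
      qed
      then show "brackets L \<subseteq> {Z. trace (Z ** conj_transpose C) = 0}" by auto
      show "cmat.subspace {Z. trace (Z ** conj_transpose C) = 0}"
        by (simp add: cmat.subspace_def matrix_add_rdistrib cscale_mult_left trace_add trace_cscale)
    qed
    then have "trace (C ** conj_transpose C) = 0"
      using C by (auto simp: lie_center_def derived_algebra_eq_span[OF L])
    then show "C = 0" by (rule trace_conj_transpose_eq_0)
  qed
  moreover have "0 \<in> lie_center ?D"
    using D by (auto simp: lie_center_def lie_ideal_def cmat.subspace_0)
  ultimately show ?thesis by blast
qed

proposition self_adjoint_semisimple_derived_algebra: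
  assumes sa: "self_adjoint L" and L: "lie_subalgebra L"
  shows "semisimple (derived_algebra L)"
proof -
  have D: "lie_subalgebra (derived_algebra L)"
    using lie_ideal_imp_subalgebra lie_ideal_derived_algebra lie_ideal_self L by blast
  have "I = {0}" if "lie_ideal I (derived_algebra L)" "lie_solvable I" for I
  proof -
    have "I \<subseteq> {0}"
      using solvable_ideal_central[OF self_adjoint_derived_algebra[OF L sa] D that]
      by (simp add: lie_center_derived_algebra[OF sa L])
    moreover have "0 \<in> I"
      using that by (auto simp: lie_ideal_def cmat.subspace_0)
    ultimately show ?thesis by blast
  qed
  with D show ?thesis by (auto simp: semisimple_def)
qed

section \<open>Polynomial functions along lines and Zariski connectedness\<close>

lemma matrix_polynomials_sum:
  assumes "finite I" and "\<And>i. i \<in> I \<Longrightarrow> f i \<in> matrix_polynomials"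
  shows "(\<lambda>A. \<Sum>i\<in>I. f i A) \<in> matrix_polynomials"
  using assms by (induction rule: finite_induct) (auto intro: matrix_polynomials.intros)

lemma matrix_polynomials_prod:
  assumes "finite I" and "\<And>i. i \<in> I \<Longrightarrow> f i \<in> matrix_polynomials"
  shows "(\<lambda>A. \<Prod>i\<in>I. f i A) \<in> matrix_polynomials"
  using assms by (induction rule: finite_induct) (auto intro: matrix_polynomials.intros)

lemma det_in_matrix_polynomials: "det \<in> matrix_polynomials"
proof -
  have "(\<lambda>A. det A) \<in> matrix_polynomials"
    unfolding det_def
    by (intro matrix_polynomials_sum matrix_polynomials.mult matrix_polynomials_prod
        matrix_polynomials.const matrix_polynomials.entry finite_permutations finite)
  then show ?thesis by simp
qed

lemma entry_difference_in_matrix_polynomials: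
  "(\<lambda>A. A $ i $ j - A $ k $ l) \<in> matrix_polynomials"
proof -
  have "(\<lambda>A. A $ i $ j + (- 1) * A $ k $ l) \<in> matrix_polynomials"
    by (intro matrix_polynomials.intros)
  then show ?thesis by simp
qed

lemma matrix_polynomial_on_line:
  assumes "f \<in> matrix_polynomials"
  shows "\<exists>p. \<forall>t. f (A + t *\<^sub>C B) = poly p t"
  using assms
proof induction
  case (const c)
  have "\<forall>t. c = poly [:c:] t" by simp
  then show ?case by blast
next
  case (entry i j)
  have "\<forall>t. (A + t *\<^sub>C B) $ i $ j = poly [:A $ i $ j, B $ i $ j:] t"
    by (simp add: cscale_def)
  then show ?case by blast
next
  case (add f g)
  then show ?case by (metis poly_add)
next
  case (mult f g)
  then show ?case by (metis poly_mult)
qed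

lemma continuous_on_matrix_polynomial:
  assumes "f \<in> matrix_polynomials"
  shows "continuous_on UNIV f"
  using assms by induction (auto intro!: continuous_intros)

lemma zariski_closed_imp_closed:
  assumes "zariski_closed Z"
  shows "closed Z"
proof -
  obtain P where P: "P \<subseteq> matrix_polynomials" and Z: "Z = {A. \<forall>f\<in>P. f A = 0}"
    using assms by (auto simp: zariski_closed_def)
  have "closed {A. f A = 0}" if "f \<in> P" for f
    using P that continuous_on_matrix_polynomial
    by (intro closed_Collect_eq continuous_on_const) blast
  then have "closed (\<Inter>f\<in>P. {A. f A = 0})" by blast
  also have "(\<Inter>f\<in>P. {A. f A = 0}) = Z" using Z by auto
  finally show ?thesis .
qed

lemma connected_imp_connectedin_zariski:
  assumes "connected S"
  shows "connectedin zariski_topology S"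
proof -
  have "continuous_map euclidean zariski_topology (\<lambda>A. A)"
    by (auto simp: continuous_map_closedin closedin_zariski zariski_closed_imp_closed)
  from connectedin_continuous_map_image[OF this, of S] show ?thesis
    using assms by (simp add: connectedin_iff_connected)
qed

text \<open>The determinant restricts to a nonzero polynomial on the complex line through two invertible
  matrices, and a plane stays connected when its finitely many roots are removed.\<close>

lemma connected_det_nonzero:
  assumes V: "cmat.subspace V"
  shows "connected {A \<in> V. det A \<noteq> 0}"
  unfolding connected_iff_connected_component
proof (intro ballI)
  fix A B assume A: "A \<in> {A \<in> V. det A \<noteq> 0}" and B: "B \<in> {A \<in> V. det A \<noteq> 0}"
  define line where "line t = A + t *\<^sub>C (B - A)" for t
  obtain p where p: "\<And>t. det (line t) = poly p t"
    using matrix_polynomial_on_line[OF det_in_matrix_polynomials] unfolding line_def by metis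
  have ends: "line 0 = A" "line 1 = B"
    by (simp_all add: line_def)
  have "poly p 0 \<noteq> 0" using A p[of 0] ends by simp
  then have "p \<noteq> 0" by auto
  then have "connected (- {t. poly p t = 0})"
    by (intro path_connected_imp_connected path_connected_complement_countable
        countable_finite poly_roots_finite) simp_all
  moreover have "continuous_on T line" for T
    unfolding line_def cscale_def by (intro continuous_intros)
  ultimately have "connected (line ` (- {t. poly p t = 0}))"
    by (intro connected_continuous_image)
  moreover have "line ` (- {t. poly p t = 0}) \<subseteq> {A \<in> V. det A \<noteq> 0}"
    using A B V by (auto simp: p line_def cmat.subspace_add cmat.subspace_diff cmat.subspace_scale simp flip: p)
  moreover have "A \<in> line ` (- {t. poly p t = 0})" "B \<in> line ` (- {t. poly p t = 0})"
    using A B ends p[of 0] p[of 1] by (auto intro: image_eqI[of _ _ 0] image_eqI[of _ _ 1])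
  ultimately show "connected_component {A \<in> V. det A \<noteq> 0} A B"
    unfolding connected_component_def by blast
qed

section \<open>Matrices invariant under permutations of the index set\<close>

definition reindex :: "('n \<Rightarrow> 'n) \<Rightarrow> complex ^ 'n ^ 'n \<Rightarrow> complex ^ 'n ^ 'n" where
  "reindex \<sigma> A = (\<chi> i j. A $ \<sigma> i $ \<sigma> j)"

definition invariant_matrices :: "('n \<Rightarrow> 'n) set \<Rightarrow> (complex ^ 'n ^ 'n) set" where
  "invariant_matrices P = {A. \<forall>\<sigma>\<in>P. reindex \<sigma> A = A}"

lemma reindex_mult:
  fixes \<sigma> :: "'n::finite \<Rightarrow> 'n"
  assumes "bij \<sigma>"
  shows "reindex \<sigma> (A ** B) = reindex \<sigma> A ** reindex \<sigma> B"
proof -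
  have "(\<Sum>k\<in>UNIV. A $ \<sigma> i $ k * B $ k $ \<sigma> j) = (\<Sum>k\<in>UNIV. A $ \<sigma> i $ \<sigma> k * B $ \<sigma> k $ \<sigma> j)"
    for i j using sum.reindex_bij_betw[OF assms, of "\<lambda>k. A $ \<sigma> i $ k * B $ k $ \<sigma> j"] by simp
  then show ?thesis
    by (simp add: reindex_def matrix_matrix_mult_def)
qed

lemma reindex_mat_1: "inj \<sigma> \<Longrightarrow> reindex \<sigma> (mat 1) = mat 1"
  by (simp add: reindex_def mat_def vec_eq_iff inj_eq)

lemma subspace_invariant_matrices: "cmat.subspace (invariant_matrices P)"
  by (simp add: cmat.subspace_def invariant_matrices_def reindex_def cscale_def vec_eq_iff)

lemma self_adjoint_invariant_matrices: "self_adjoint (invariant_matrices P)"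
  by (simp add: self_adjoint_def invariant_matrices_def reindex_def conj_transpose_def vec_eq_iff)

lemma invariant_matrices_mult:
  fixes P :: "('n::finite \<Rightarrow> 'n) set"
  assumes "\<And>\<sigma>. \<sigma> \<in> P \<Longrightarrow> bij \<sigma>" and "A \<in> invariant_matrices P" and "B \<in> invariant_matrices P"
  shows "A ** B \<in> invariant_matrices P"
  using assms by (simp add: invariant_matrices_def reindex_mult)

lemma invariant_matrices_mat_1:
  assumes "\<And>\<sigma>. \<sigma> \<in> P \<Longrightarrow> bij \<sigma>"
  shows "mat 1 \<in> invariant_matrices P"
  using assms by (simp add: invariant_matrices_def reindex_mat_1 bij_is_inj)

text \<open>Reindexing respects products, so the reindexed inverse is again an inverse of \<open>A\<close>.\<close>

lemma invariant_matrices_inverse: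
  fixes P :: "('n::finite \<Rightarrow> 'n) set"
  assumes P: "\<And>\<sigma>. \<sigma> \<in> P \<Longrightarrow> bij \<sigma>" and A: "A \<in> invariant_matrices P"
    and AB: "A ** B = mat 1" and BA: "B ** A = mat 1"
  shows "B \<in> invariant_matrices P"
proof -
  have "reindex \<sigma> B = B" if "\<sigma> \<in> P" for \<sigma>
  proof -
    have "A ** reindex \<sigma> B = reindex \<sigma> (A ** B)"
      using A that by (simp add: reindex_mult P invariant_matrices_def)
    also have "\<dots> = mat 1"
      by (simp add: AB reindex_mat_1 bij_is_inj P that)
    finally show ?thesis
      by (metis BA matrix_mul_assoc matrix_mul_lid matrix_mul_rid)
  qed
  then show ?thesis by (simp add: invariant_matrices_def)
qed

lemma lie_subalgebra_invariant_matrices: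
  fixes P :: "('n::finite \<Rightarrow> 'n) set"
  assumes "\<And>\<sigma>. \<sigma> \<in> P \<Longrightarrow> bij \<sigma>"
  shows "lie_subalgebra (invariant_matrices P)"
  by (simp add: lie_subalgebra_def lie_bracket_def subspace_invariant_matrices
      cmat.subspace_diff invariant_matrices_mult assms)

lemma zariski_closed_invariant_matrices:
  fixes P :: "('n::finite \<Rightarrow> 'n) set"
  shows "zariski_closed (invariant_matrices P)"
proof -
  let ?Q = "{(\<lambda>A::complex ^ 'n ^ 'n. A $ i $ j - A $ \<sigma> i $ \<sigma> j) | i j \<sigma>. \<sigma> \<in> P}"
  have "?Q \<subseteq> matrix_polynomials"
    by (auto intro: entry_difference_in_matrix_polynomials)
  moreover have "invariant_matrices P = {A. \<forall>f\<in>?Q. f A = 0}"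
  proof (intro Set.equalityI subsetI)
    fix A assume A: "A \<in> {A. \<forall>f\<in>?Q. f A = 0}"
    have "A $ \<sigma> i $ \<sigma> j = A $ i $ j" if "\<sigma> \<in> P" for \<sigma> i j
    proof -
      have "(\<lambda>A. A $ i $ j - A $ \<sigma> i $ \<sigma> j) \<in> ?Q" using that by blast
      from bspec[OF CollectD[OF A] this] show ?thesis by simp
    qed
    then show "A \<in> invariant_matrices P"
      by (simp add: invariant_matrices_def reindex_def vec_eq_iff)
  qed (auto simp: invariant_matrices_def reindex_def vec_eq_iff)
  ultimately show ?thesis unfolding zariski_closed_def by blast
qed

text \<open>Tangent vectors satisfy the linear equations \<open>A\<^bsub>\<sigma>i,\<sigma>j\<^esub> = A\<^bsub>ij\<^esub>\<close>, which equal their own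
  differentials. Conversely, a polynomial that vanishes on the group vanishes on the whole line
  \<open>1 + t X\<close> and not only where this is invertible: its product with the determinant is zero
  there, and the determinant is \<open>1\<close> at \<open>t = 0\<close>.\<close>

lemma lie_algebra_of_invertible_invariant_matrices:
  fixes P :: "('n::finite \<Rightarrow> 'n) set"
  assumes P: "\<And>\<sigma>. \<sigma> \<in> P \<Longrightarrow> bij \<sigma>"
  shows "lie_algebra_of {A \<in> invariant_matrices P. det A \<noteq> 0} = invariant_matrices P"
proof (intro Set.equalityI subsetI)
  fix X assume X: "X \<in> lie_algebra_of {A \<in> invariant_matrices P. det A \<noteq> 0}"
  have "X $ \<sigma> i $ \<sigma> j = X $ i $ j" if "\<sigma> \<in> P" for \<sigma> i j
  proof -
    let ?f = "\<lambda>A::complex ^ 'n ^ 'n. A $ \<sigma> i $ \<sigma> j - A $ i $ j"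
    have "\<forall>A\<in>{A \<in> invariant_matrices P. det A \<noteq> 0}. ?f A = 0"
      using that by (auto simp: invariant_matrices_def reindex_def vec_eq_iff)
    moreover have "?f \<in> matrix_polynomials"
      by (rule entry_difference_in_matrix_polynomials)
    moreover note bspec[OF CollectD[OF X[unfolded lie_algebra_of_def]] this]
    ultimately have d0: "((\<lambda>t. ?f (mat 1 + t *\<^sub>C X)) has_field_derivative 0) (at 0)"
      by blast
    have d1: "((\<lambda>t. ?f (mat 1 + t *\<^sub>C X)) has_field_derivative ?f X) (at 0)"
      unfolding cscale_def by (auto intro!: derivative_eq_intros)
    show ?thesis
      using DERIV_unique[OF d0 d1] by simp
  qed
  then show "X \<in> invariant_matrices P"
    by (simp add: invariant_matrices_def reindex_def vec_eq_iff)
next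
  fix X assume X: "X \<in> invariant_matrices P"
  have "((\<lambda>t. f (mat 1 + t *\<^sub>C X)) has_field_derivative 0) (at 0)"
    if f: "f \<in> matrix_polynomials" and
      vanish: "\<forall>A\<in>{A \<in> invariant_matrices P. det A \<noteq> 0}. f A = 0" for f
  proof -
    obtain p where p: "\<And>t. f (mat 1 + t *\<^sub>C X) = poly p t"
      using matrix_polynomial_on_line[OF f] by metis
    obtain q where q: "\<And>t. det (mat 1 + t *\<^sub>C X) = poly q t"
      using matrix_polynomial_on_line[OF det_in_matrix_polynomials] by metis
    have "mat 1 + t *\<^sub>C X \<in> invariant_matrices P" for t
      using X by (intro cmat.subspace_add cmat.subspace_scale subspace_invariant_matrices
          invariant_matrices_mat_1 P)
    then have "poly p t = 0" if "poly q t \<noteq> 0" for t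
      using vanish that unfolding p[symmetric] q[symmetric] by blast
    then have "poly (p * q) t = 0" for t
      by auto
    then have "p * q = 0"
      using poly_all_0_iff_0 by blast
    moreover have "q \<noteq> 0" using q[of 0] by auto
    ultimately have "p = 0" by simp
    then show ?thesis by (simp add: p)
  qed
  then show "X \<in> lie_algebra_of {A \<in> invariant_matrices P. det A \<noteq> 0}"
    by (simp add: lie_algebra_of_def)
qed

lemma group_GL: "Group.group (GL :: (complex ^ 'n ^ 'n) monoid)"
proof (rule groupI)
  fix A :: "complex ^ 'n ^ 'n" assume "A \<in> carrier GL"
  then show "\<exists>B\<in>carrier GL. B \<otimes>\<^bsub>GL\<^esub> A = \<one>\<^bsub>GL\<^esub>"
    by (auto simp: GL_def invertible_def)
qed (auto simp: GL_def invertible_det_nz det_mul matrix_mul_assoc)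

proposition linear_algebraic_group_invertible_invariant_matrices:
  fixes P :: "('n::finite \<Rightarrow> 'n) set"
  assumes P: "\<And>\<sigma>. \<sigma> \<in> P \<Longrightarrow> bij \<sigma>"
  shows "linear_algebraic_group {A \<in> invariant_matrices P. det A \<noteq> 0}"
proof -
  interpret GL: Group.group "GL :: (complex ^ 'n ^ 'n) monoid" by (rule group_GL)
  let ?S = "{A \<in> invariant_matrices P. det A \<noteq> 0}"
  have S: "?S = invariant_matrices P \<inter> carrier GL"
    by (auto simp: GL_def invertible_det_nz)
  have "subgroup ?S GL"
  proof (rule GL.subgroupI)
    show "?S \<subseteq> carrier GL" using S by blast
    show "?S \<noteq> {}" using invariant_matrices_mat_1[OF P] by fastforce
    show "A \<otimes>\<^bsub>GL\<^esub> B \<in> ?S" if "A \<in> ?S" "B \<in> ?S" for A B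
      using that by (simp add: GL_def invariant_matrices_mult P det_mul)
    show "inv\<^bsub>GL\<^esub> A \<in> ?S" if "A \<in> ?S" for A
    proof -
      have A: "A \<in> invariant_matrices P" "A \<in> carrier GL" using that S by auto
      then have "A ** inv\<^bsub>GL\<^esub> A = mat 1" "inv\<^bsub>GL\<^esub> A ** A = mat 1"
        using GL.r_inv[of A] GL.l_inv[of A] by (simp_all add: GL_def)
      then have "inv\<^bsub>GL\<^esub> A \<in> invariant_matrices P"
        using invariant_matrices_inverse[OF P A(1)] by blast
      then show ?thesis using S A GL.inv_closed by blast
    qed
  qed
  moreover have "closedin (subtopology zariski_topology (carrier GL)) ?S"
    unfolding closedin_subtopology S
    using closedin_zariski zariski_closed_invariant_matrices by blast
  ultimately show ?thesis
    by (simp add: linear_algebraic_group_def)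
qed

section \<open>Frobenius matrices\<close>

definition right_translations ::
    "('a, 'b) monoid_scheme \<Rightarrow> ('n \<Rightarrow> 'a) \<Rightarrow> ('n \<Rightarrow> 'n) set" where
  "right_translations G e = {\<sigma>. \<exists>g\<in>carrier G. \<forall>i. e (\<sigma> i) = e i \<otimes>\<^bsub>G\<^esub> g}"

lemma bij_right_translation:
  fixes e :: "'n::finite \<Rightarrow> 'a"
  assumes "Group.group G" and e: "bij_betw e UNIV (carrier G)" and "\<sigma> \<in> right_translations G e"
  shows "bij \<sigma>"
proof -
  interpret G: Group.group G by fact
  obtain g where g: "g \<in> carrier G" "\<And>i. e (\<sigma> i) = e i \<otimes>\<^bsub>G\<^esub> g"
    using assms by (auto simp: right_translations_def)
  have carr: "e i \<in> carrier G" for i using e by (auto simp: bij_betw_def)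
  have "inj \<sigma>"
  proof (rule injI)
    fix i j assume "\<sigma> i = \<sigma> j"
    then have "e i \<otimes>\<^bsub>G\<^esub> g = e j \<otimes>\<^bsub>G\<^esub> g" by (metis g(2))
    then have "e i = e j" using g(1) carr by simp
    then show "i = j" using e by (auto simp: bij_betw_def inj_eq)
  qed
  then show ?thesis by (simp add: bij_def finite_UNIV_inj_surj)
qed

text \<open>Translating by \<open>g\<close> cancels in \<open>x g (y g)\<inverse> = x y\<inverse>\<close>. Conversely, translating the index pair \<open>(x, y)\<close>
  by \<open>y\<inverse>\<close> moves it to \<open>(x y\<inverse>, 1)\<close>, so an invariant matrix is determined by its column at the
  identity.\<close>

lemma range_frobenius_matrix:
  fixes e :: "'n::finite \<Rightarrow> 'a"
  assumes "Group.group G" and e: "bij_betw e UNIV (carrier G)"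
  shows "range (frobenius_matrix G e) = invariant_matrices (right_translations G e)"
proof (intro Set.equalityI subsetI)
  interpret G: Group.group G by fact
  have carr: "e i \<in> carrier G" for i using e by (auto simp: bij_betw_def)
  have index: "e (inv_into UNIV e x) = x" if "x \<in> carrier G" for x
    using e that by (simp add: bij_betw_inv_into_right)
  {
    fix A assume "A \<in> range (frobenius_matrix G e)"
    then obtain a where A: "A = frobenius_matrix G e a" by blast
    have "e (\<sigma> i) \<otimes>\<^bsub>G\<^esub> inv\<^bsub>G\<^esub> e (\<sigma> j) = e i \<otimes>\<^bsub>G\<^esub> inv\<^bsub>G\<^esub> e j"
      if \<sigma>: "\<sigma> \<in> right_translations G e" for \<sigma> i j
    proof -
      obtain g where g: "g \<in> carrier G" "\<And>i. e (\<sigma> i) = e i \<otimes>\<^bsub>G\<^esub> g"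
        using \<sigma> by (auto simp: right_translations_def)
      have "g \<otimes>\<^bsub>G\<^esub> (inv\<^bsub>G\<^esub> g \<otimes>\<^bsub>G\<^esub> inv\<^bsub>G\<^esub> e j) = inv\<^bsub>G\<^esub> e j"
        using g(1) carr by (simp flip: G.m_assoc)
      then show ?thesis
        using g carr by (simp add: G.inv_mult_group G.m_assoc)
    qed
    then show "A \<in> invariant_matrices (right_translations G e)"
      by (simp add: A invariant_matrices_def reindex_def frobenius_matrix_def)
  next
    fix A assume A: "A \<in> invariant_matrices (right_translations G e)"
    define a where "a x = A $ inv_into UNIV e x $ inv_into UNIV e \<one>\<^bsub>G\<^esub>" for x
    have "A $ i $ j = a (e i \<otimes>\<^bsub>G\<^esub> inv\<^bsub>G\<^esub> e j)" for i j
    proof -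
      define \<sigma> where "\<sigma> k = inv_into UNIV e (e k \<otimes>\<^bsub>G\<^esub> inv\<^bsub>G\<^esub> e j)" for k
      have "\<sigma> \<in> right_translations G e"
        unfolding right_translations_def \<sigma>_def
        using carr by (auto intro!: bexI[of _ "inv\<^bsub>G\<^esub> e j"] simp: index)
      then have "A $ \<sigma> i $ \<sigma> j = A $ i $ j"
        using A by (simp add: invariant_matrices_def reindex_def vec_eq_iff)
      then show ?thesis using carr[of j] by (simp add: a_def \<sigma>_def)
    qed
    then have "A = frobenius_matrix G e a"
      by (simp add: frobenius_matrix_def vec_eq_iff)
    then show "A \<in> range (frobenius_matrix G e)" by blast
  }
qed

text \<open>Inverting both indices replaces \<open>x y\<inverse>\<close> by \<open>x\<inverse> y = y x\<inverse>\<close> in an abelian group, which is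
  transposition. As \<open>A B\<close> is again a Frobenius matrix,
  \<open>(A B)\<^sup>T = A\<^sup>T B\<^sup>T = (B A)\<^sup>T\<close>.\<close>

lemma frobenius_matrices_commute:
  fixes e :: "'n::finite \<Rightarrow> 'a"
  assumes "comm_group G" and e: "bij_betw e UNIV (carrier G)"
    and A: "A \<in> range (frobenius_matrix G e)" and B: "B \<in> range (frobenius_matrix G e)"
  shows "A ** B = B ** A"
proof -
  interpret G: comm_group G by fact
  have carr: "e i \<in> carrier G" for i using e by (auto simp: bij_betw_def)
  define \<iota> where "\<iota> i = inv_into UNIV e (inv\<^bsub>G\<^esub> e i)" for i
  have \<iota>: "e (\<iota> i) = inv\<^bsub>G\<^esub> e i" for i
    using e carr by (simp add: \<iota>_def bij_betw_inv_into_right)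
  have "inj \<iota>"
    by (rule injI) (metis \<iota> carr G.inv_inv e bij_betw_def inj_eq)
  then have bij: "bij \<iota>" by (simp add: bij_def finite_UNIV_inj_surj)
  have transp: "reindex \<iota> C = transpose C" if "C \<in> range (frobenius_matrix G e)" for C
    using that carr
    by (auto simp: reindex_def transpose_def frobenius_matrix_def vec_eq_iff \<iota> G.m_comm)
  have "A ** B \<in> range (frobenius_matrix G e)"
    using A B unfolding range_frobenius_matrix[OF G.is_group e]
    by (intro invariant_matrices_mult bij_right_translation[OF G.is_group e])
  then have "transpose (A ** B) = reindex \<iota> (A ** B)"
    by (rule transp[symmetric])
  also have "\<dots> = reindex \<iota> A ** reindex \<iota> B"
    by (rule reindex_mult[OF bij])
  also have "\<dots> = transpose (B ** A)"
    by (simp add: transp A B matrix_transpose_mul)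
  finally show ?thesis by (metis transpose_transpose)
qed

theorem theorem3p1:
  fixes G :: "('a, 'b) monoid_scheme" and e :: "'n::finite \<Rightarrow> 'a"
    and S :: "(complex ^ 'n ^ 'n) set"
  assumes "Group.group G" and "finite (carrier G)" and "card (carrier G) \<ge> 2"
    and "bij_betw e UNIV (carrier G)"
    and "S = invertible_frobenius_matrices G e"
  shows "linear_algebraic_group S \<and> connectedin zariski_topology S \<and>
    (\<not> comm_group G \<longrightarrow> linearly_reductive S) \<and>
    (comm_group G \<longrightarrow> comm_group (GL\<lparr>carrier := S\<rparr>)) \<and>
    (\<not> comm_group G \<longrightarrow> semisimple (derived_algebra (lie_algebra_of S)))"
proof -
  let ?P = "right_translations G e"
  note bij = bij_right_translation[OF assms(1) assms(4)]
  have S: "S = {A \<in> invariant_matrices ?P. det A \<noteq> 0}"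
    unfolding assms(5) invertible_frobenius_matrices_def
    by (auto simp flip: range_frobenius_matrix[OF assms(1) assms(4)])
  have lie: "lie_algebra_of S = invariant_matrices ?P"
    unfolding S by (rule lie_algebra_of_invertible_invariant_matrices) (rule bij)
  have group: "linear_algebraic_group S"
    unfolding S by (rule linear_algebraic_group_invertible_invariant_matrices) (rule bij)
  have subalgebra: "lie_subalgebra (invariant_matrices ?P)"
    by (rule lie_subalgebra_invariant_matrices) (rule bij)
  have "comm_group (GL\<lparr>carrier := S\<rparr>)" if "comm_group G"
  proof (rule group.group_comm_groupI)
    show "Group.group (GL\<lparr>carrier := S\<rparr>)"
      using group by (intro subgroup.subgroup_is_group group_GL) (simp add: linear_algebraic_group_def)
  next
    fix A B assume "A \<in> carrier (GL\<lparr>carrier := S\<rparr>)" "B \<in> carrier (GL\<lparr>carrier := S\<rparr>)"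
    then have "A \<in> range (frobenius_matrix G e)" "B \<in> range (frobenius_matrix G e)"
      by (simp_all add: S range_frobenius_matrix[OF assms(1) assms(4)])
    then show "A \<otimes>\<^bsub>GL\<lparr>carrier := S\<rparr>\<^esub> B = B \<otimes>\<^bsub>GL\<lparr>carrier := S\<rparr>\<^esub> A"
      using frobenius_matrices_commute[OF that assms(4)] by (simp add: GL_def)
  qed
  moreover have "connectedin zariski_topology S"
    unfolding S
    by (intro connected_imp_connectedin_zariski connected_det_nonzero subspace_invariant_matrices)
  ultimately show ?thesis
    using group subalgebra self_adjoint_invariant_matrices[of ?P]
    by (simp add: linearly_reductive_def lie self_adjoint_reductive
        self_adjoint_semisimple_derived_algebra)
qed

end
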